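(* Let $A\in\mathbb{R}^{n\times n}$ be an $H_+$-matrix, written $A=D-L-U$ with $D=\mathrm{diag}(A)$ and $-L$, $-U$ the strictly lower and strictly upper triangular parts of $A$. Let $q\in\mathbb{R}^n$, $\zeta:\mathbb{R}^n\to\mathbb{R}^n$, $\gamma>0$, and suppose that $\mathrm{ICP}(q,A,\zeta)$ has a unique solution $z^*$. Let $\Psi\in\mathbb{R}^{n\times n}$ be a nonnegative matrix such that $|\zeta(x)-\zeta(y)|\le\Psi|x-y|$ for all $x,y\in\mathbb{R}^n$. Let $\Omega_1,\Omega_2\in\mathbb{R}^{n\times n}$ be positive diagonal matrices, $\phi\in\mathbb{R}^{n\times n}$ a diagonal matrix, and let $A=(M+\phi)-(N+\phi)$ be an $H$-splitting of $A$, where $M,N$ are the matrices of the NRMAOR method. Let $e=(1,1,\dots,1)^T\in\mathbb{R}^n$. Suppose there exists a positive diagonal matrix $V$ such that $(\langle M+\phi\rangle-|N+\phi|)V$ is a strictly diagonally dominant matrix and one of the following conditions holds: (1) $\Omega_2\ge D\Omega_1$ and $\left(\langle M\Omega_1+\phi\Omega_1\rangle-|N\Omega_1+\phi\Omega_1|-|A|\Psi|A^{-1}|\Omega_2\right)Ve>0$; (2) $0<\Omega_2<D\Omega_1$ (comparing diagonal entries) and $\left(\Omega_2-D\Omega_1+\langle M\Omega_1+\phi\Omega_1\rangle-|N\Omega_1+\phi\Omega_1|-|A|\Psi|A^{-1}|\Omega_2\right)Ve>0$. Then for any initial vector $x^{(0)}\in\mathbb{R}^n$ the sequence $\{z^{(k)}\}_{k=0}^{\infty}\subset\mathbb{R}^n$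 generated by the NRMAOR method converges to the unique solution $z^*$ of $\mathrm{ICP}(q,A,\zeta)$.
   Context: The problem $\mathrm{ICP}(q,A,\zeta)$ is to find $z\in\mathbb{R}^n$ such that $Az+q\ge 0$, $z-\zeta(z)\ge 0$ and $(z-\zeta(z))^T(Az+q)=0$. Absolute values and inequalities of vectors and matrices are entrywise. The comparison matrix $\langle C\rangle$ of $C=(c_{ij})$ has entries $|c_{ii}|$ on the diagonal and $-|c_{ij}|$ for $i\ne j$. A $Z$-matrix has nonpositive off-diagonal entries; an $M$-matrix is a nonsingular $Z$-matrix with entrywise nonnegative inverse; an $H$-matrix is a matrix whose comparison matrix is an $M$-matrix; an $H_+$-matrix is an $H$-matrix with positive diagonal entries. A splitting $A=\tilde M-\tilde N$ is an $H$-splitting if $\langle\tilde M\rangle-|\tilde N|$ is an $M$-matrix. A matrix $C=(c_{ij})$ is strictly diagonally dominant if $|c_{ii}|>\sum_{j\ne i}|c_{ij}|$ for all $i$. NRMAOR method (new relaxation modulus-based accelerated overrelaxation iterative method) with real parameters $\alpha\neq0$, $\beta$: put $$M=\tfrac1\alpha(D-\beta L),\qquad N=\tfrac1\alpha\left[(1-\alpha)D+(\alpha-\beta)L+\alpha U\right],$$ so that $A=M-N=(M+\phi)-(N+\phi)$, where $\Omega_2+M\Omega_1+\phi\Omega_1$ is supposed nonsingular as part of the setup of the method. Given $x^{(0)}\in\mathbb{R}^n$, for $k=0,1,2,\dots$ let $z^{(k)}$ be the solution of $$Az^{(k)}=\tfrac{1}{\gamma}\Omega_2\left(|x^{(k)}|-x^{(k)}\right)-q,$$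 and set $$x^{(k+1)}=(\Omega_2+M\Omega_1+\phi\Omega_1)^{-1}\left[(N\Omega_1+\phi\Omega_1)x^{(k)}+(\Omega_2-A\Omega_1)|x^{(k)}|-\gamma A\zeta(z^{(k)})-\gamma q\right].$$ (The infinite sequence is considered, with no stopping test.) *)

theory Defs
  imports "HOL-Analysis.Analysis"
begin

text \<open>
  On \<^typ>\<open>real^'n\<close> and \<^typ>\<open>real^'n^'n\<close> the library operations \<open>\<bar>_\<bar>\<close> and \<open>\<le>\<close> are entrywise,
  whereas \<open><\<close> is only the strict part of \<open>\<le>\<close>. Entrywise strict inequalities are therefore
  written out by components.
\<close>

definition comparison_matrix :: "real^'n^'n \<Rightarrow> real^'n^'n"  (\<open>\<langle>_\<rangle>\<close>) where
  "\<langle>C\<rangle> = (\<chi> i j. if i = j then \<bar>C $ i $ i\<bar> else - \<bar>C $ i $ j\<bar>)"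

definition Z_matrix :: "real^'n^'n \<Rightarrow> bool" where
  "Z_matrix C \<longleftrightarrow> (\<forall>i j. i \<noteq> j \<longrightarrow> C $ i $ j \<le> 0)"

definition M_matrix :: "real^'n^'n \<Rightarrow> bool" where
  "M_matrix C \<longleftrightarrow> Z_matrix C \<and> invertible C \<and> 0 \<le> matrix_inv C"

definition H_matrix :: "real^'n^'n \<Rightarrow> bool" where
  "H_matrix C \<longleftrightarrow> M_matrix \<langle>C\<rangle>"

definition H_plus_matrix :: "real^'n^'n \<Rightarrow> bool" where
  "H_plus_matrix C \<longleftrightarrow> H_matrix C \<and> (\<forall>i. 0 < C $ i $ i)"

definition H_splitting :: "real^'n^'n \<Rightarrow> real^'n^'n \<Rightarrow> real^'n^'n \<Rightarrow> bool" where
  "H_splitting A M N \<longleftrightarrow> A = M - N \<and> M_matrix (\<langle>M\<rangle> - \<bar>N\<bar>)"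

definition strictly_diagonally_dominant :: "real^'n^'n \<Rightarrow> bool" where
  "strictly_diagonally_dominant C \<longleftrightarrow> (\<forall>i. (\<Sum>j\<in>UNIV - {i}. \<bar>C $ i $ j\<bar>) < \<bar>C $ i $ i\<bar>)"

definition diagonal_matrix :: "real^'n^'n \<Rightarrow> bool" where
  "diagonal_matrix C \<longleftrightarrow> (\<forall>i j. i \<noteq> j \<longrightarrow> C $ i $ j = 0)"

definition positive_diagonal_matrix :: "real^'n^'n \<Rightarrow> bool" where
  "positive_diagonal_matrix C \<longleftrightarrow> diagonal_matrix C \<and> (\<forall>i. 0 < C $ i $ i)"

text \<open>
  The ordering of the index type plays the role of the ordering of \<open>1, \<dots>, n\<close>. The signs are
  those of the convention \<open>A = D - L - U\<close>.
\<close>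

definition diag_part :: "real^'n^'n \<Rightarrow> real^'n^'n" where
  "diag_part A = (\<chi> i j. if i = j then A $ i $ j else 0)"

definition lower_part :: "real^'n::{finite,linorder}^'n::{finite,linorder} \<Rightarrow> real^'n::{finite,linorder}^'n::{finite,linorder}" where
  "lower_part A = (\<chi> i j. if j < i then - A $ i $ j else 0)"

definition upper_part :: "real^'n::{finite,linorder}^'n::{finite,linorder} \<Rightarrow> real^'n::{finite,linorder}^'n::{finite,linorder}" where
  "upper_part A = (\<chi> i j. if i < j then - A $ i $ j else 0)"

lemma matrix_DLU_splitting: "A = diag_part A - lower_part A - upper_part A"
  by (auto simp: vec_eq_iff diag_part_def lower_part_def upper_part_def)

definition ICP_solution ::
    "real^'n \<Rightarrow> real^'n^'n \<Rightarrow> (real^'n \<Rightarrow> real^'n) \<Rightarrow> real^'n \<Rightarrow> bool" where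
  "ICP_solution q A \<zeta> z \<longleftrightarrow>
     0 \<le> A *v z + q \<and> 0 \<le> z - \<zeta> z \<and> (z - \<zeta> z) \<bullet> (A *v z + q) = 0"

definition NRMAOR_z_of ::
    "real^'n^'n \<Rightarrow> real^'n \<Rightarrow> real^'n^'n \<Rightarrow> real \<Rightarrow> real^'n \<Rightarrow> real^'n" where
  "NRMAOR_z_of A q \<Omega>\<^sub>2 \<gamma> x =
     (THE z. A *v z = (1 / \<gamma>) *\<^sub>R (\<Omega>\<^sub>2 *v (\<bar>x\<bar> - x)) - q)"

primrec NRMAOR_x ::
    "real^'n^'n \<Rightarrow> real^'n^'n \<Rightarrow> real^'n^'n \<Rightarrow> real^'n^'n \<Rightarrow> real^'n^'n \<Rightarrow> real^'n^'n \<Rightarrow> real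
     \<Rightarrow> real^'n \<Rightarrow> (real^'n \<Rightarrow> real^'n) \<Rightarrow> real^'n \<Rightarrow> nat \<Rightarrow> real^'n" where
  "NRMAOR_x A M N \<phi> \<Omega>\<^sub>1 \<Omega>\<^sub>2 \<gamma> q \<zeta> x0 0 = x0"
| "NRMAOR_x A M N \<phi> \<Omega>\<^sub>1 \<Omega>\<^sub>2 \<gamma> q \<zeta> x0 (Suc k) =
     (let x = NRMAOR_x A M N \<phi> \<Omega>\<^sub>1 \<Omega>\<^sub>2 \<gamma> q \<zeta> x0 k;
          z = NRMAOR_z_of A q \<Omega>\<^sub>2 \<gamma> x
      in matrix_inv (\<Omega>\<^sub>2 + M ** \<Omega>\<^sub>1 + \<phi> ** \<Omega>\<^sub>1) *v
           ((N ** \<Omega>\<^sub>1 + \<phi> ** \<Omega>\<^sub>1) *v x + (\<Omega>\<^sub>2 - A ** \<Omega>\<^sub>1) *v \<bar>x\<bar>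
            - \<gamma> *\<^sub>R (A *v \<zeta> z) - \<gamma> *\<^sub>R q))"

definition NRMAOR_z ::
    "real^'n^'n \<Rightarrow> real^'n^'n \<Rightarrow> real^'n^'n \<Rightarrow> real^'n^'n \<Rightarrow> real^'n^'n \<Rightarrow> real^'n^'n \<Rightarrow> real
     \<Rightarrow> real^'n \<Rightarrow> (real^'n \<Rightarrow> real^'n) \<Rightarrow> real^'n \<Rightarrow> nat \<Rightarrow> real^'n" where
  "NRMAOR_z A M N \<phi> \<Omega>\<^sub>1 \<Omega>\<^sub>2 \<gamma> q \<zeta> x0 k =
     NRMAOR_z_of A q \<Omega>\<^sub>2 \<gamma> (NRMAOR_x A M N \<phi> \<Omega>\<^sub>1 \<Omega>\<^sub>2 \<gamma> q \<zeta> x0 k)"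

end

theory Submission
  imports Defs
begin

text \<open>
  Put \<open>x\<^sup>* = (\<gamma>/2) (\<Omega>\<^sub>1\<^sup>-\<^sup>1 (z\<^sup>* - \<zeta> z\<^sup>*) - \<Omega>\<^sub>2\<^sup>-\<^sup>1 (A z\<^sup>* + q))\<close>. By complementarity \<open>z\<^sup>*\<close> and \<open>x\<^sup>*\<close> are a
  fixed point of the iteration, and the errors \<open>d = x - x\<^sup>*\<close> of consecutive iterates satisfy
  \<open>\<bar>P d'\<bar> \<le> R \<bar>d\<bar>\<close> with \<open>P = \<Omega>\<^sub>2 + (M + \<phi>) \<Omega>\<^sub>1\<close> and
  \<open>R = \<bar>(N + \<phi>) \<Omega>\<^sub>1\<bar> + \<bar>\<Omega>\<^sub>2 - A \<Omega>\<^sub>1\<bar> + 2 \<bar>A\<bar> \<Psi> \<bar>A\<^sup>-\<^sup>1\<bar> \<Omega>\<^sub>2\<close>. Entrywise, \<open>\<langle>P\<rangle> - R\<close> is at least twice the matrix in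
  condition (1) or (2), so that \<open>R v < \<langle>P\<rangle> v\<close> for the positive vector \<open>v = V e\<close>, and the error
  contracts in the maximum norm weighted by \<open>v\<close>.
\<close>

section \<open>Entrywise estimates and diagonal scaling\<close>

lemma matrix_vector_mult_mono:
  fixes A B :: "real^'n^'m" and x y :: "real^'n"
  assumes "0 \<le> A" "A \<le> B" "0 \<le> x" "x \<le> y"
  shows "A *v x \<le> B *v y"
  using assms order_trans[OF assms(1,2)] unfolding less_eq_vec_def matrix_vector_mult_def
  by (auto intro!: sum_mono mult_mono)

text \<open>Only the vector has to be nonnegative here, so that matrices of mixed sign such as
  comparison matrices can be compared along a positive vector.\<close>

lemma matrix_vector_mult_mono_left:
  fixes A B :: "real^'n^'m" and x :: "real^'n"
  assumes "A \<le> B" "0 \<le> x"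
  shows "A *v x \<le> B *v x"
  using assms unfolding less_eq_vec_def matrix_vector_mult_def
  by (auto intro!: sum_mono mult_right_mono)

lemma abs_matrix_vector_mult_le:
  fixes A :: "real^'n^'m" and x :: "real^'n"
  shows "\<bar>A *v x\<bar> \<le> \<bar>A\<bar> *v \<bar>x\<bar>"
  unfolding less_eq_vec_def matrix_vector_mult_def abs_vec_def
  by (auto simp flip: abs_mult intro!: sum_abs)

lemma abs_matrix_vector_mult_bound:
  fixes A :: "real^'n^'m" and x y :: "real^'n"
  assumes "\<bar>x\<bar> \<le> y"
  shows "\<bar>A *v x\<bar> \<le> \<bar>A\<bar> *v y"
  by (rule order_trans[OF abs_matrix_vector_mult_le matrix_vector_mult_mono]) (use assms in auto)

lemma matrix_mult_nonneg:
  fixes A :: "real^'n^'m" and B :: "real^'k^'n"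
  assumes "0 \<le> A" "0 \<le> B"
  shows "0 \<le> A ** B"
  using assms unfolding less_eq_vec_def matrix_matrix_mult_def
  by (auto intro!: sum_nonneg)

lemma matrix_add_rdistrib:
  fixes A B :: "'a::semiring_1^'n^'m" and C :: "'a^'k^'n"
  shows "(A + B) ** C = A ** C + B ** C"
  by (simp add: vec_eq_iff matrix_matrix_mult_def distrib_right sum.distrib)

lemma diagonal_matrix_mult_right:
  fixes A B :: "real^'n^'n"
  assumes "diagonal_matrix B"
  shows "(A ** B) $ i $ j = A $ i $ j * B $ j $ j"
proof -
  have "(A ** B) $ i $ j = (\<Sum>k\<in>UNIV. if k = j then A $ i $ j * B $ j $ j else 0)"
    using assms unfolding matrix_matrix_mult_def diagonal_matrix_def vec_lambda_beta
    by (intro sum.cong) auto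
  then show ?thesis by simp
qed

lemma diagonal_matrix_mult_vec:
  fixes B :: "real^'n^'n"
  assumes "diagonal_matrix B"
  shows "(B *v x) $ i = B $ i $ i * x $ i"
proof -
  have "(B *v x) $ i = (\<Sum>k\<in>UNIV. if k = i then B $ i $ i * x $ i else 0)"
    using assms unfolding matrix_vector_mult_def diagonal_matrix_def vec_lambda_beta
    by (intro sum.cong) auto
  then show ?thesis by simp
qed

lemma positive_diagonal_matrix_nonneg:
  assumes "positive_diagonal_matrix B"
  shows "0 \<le> B"
  using assms unfolding positive_diagonal_matrix_def diagonal_matrix_def less_eq_vec_def
  by (metis less_imp_le order_refl zero_index)

section \<open>Comparison matrices and M-matrices\<close>

lemma comparison_matrix_diff_le:
  fixes M N :: "real^'n^'n"
  shows "\<langle>M\<rangle> - \<bar>N\<bar> \<le> \<langle>M - N\<rangle>"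
  unfolding less_eq_vec_def comparison_matrix_def abs_vec_def by auto

lemma matrix_inv:
  fixes C :: "'a::semiring_1^'n^'m"
  assumes "invertible C"
  shows "C ** matrix_inv C = mat 1" "matrix_inv C ** C = mat 1"
  using assms someI_ex[of "\<lambda>B. C ** B = mat 1 \<and> B ** C = mat 1"]
  unfolding invertible_def matrix_inv_def by auto

text \<open>In the diagonal entry \<open>1\<close> of \<open>C ** matrix_inv C\<close> all terms
  with \<open>j \<noteq> i\<close> are nonpositive. Hence \<open>C $ i $ i\<close> times a
  nonnegative number is at least \<open>1\<close>.\<close>

lemma M_matrix_diagonal_pos:
  assumes "M_matrix C"
  shows "0 < C $ i $ i"
proof -
  have Z: "\<And>i j. i \<noteq> j \<Longrightarrow> C $ i $ j \<le> 0" and inv: "invertible C" and nn: "0 \<le> matrix_inv C"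
    using assms unfolding M_matrix_def Z_matrix_def by auto
  have nn': "0 \<le> matrix_inv C $ k $ l" for k l
    using nn unfolding less_eq_vec_def by auto
  have "(C ** matrix_inv C) $ i $ i = 1"
    using matrix_inv(1)[OF inv] by (simp add: mat_def)
  then have "1 = (\<Sum>j\<in>UNIV. C $ i $ j * matrix_inv C $ j $ i)"
    by (simp add: matrix_matrix_mult_def)
  also have "\<dots> = C $ i $ i * matrix_inv C $ i $ i
      + (\<Sum>j\<in>UNIV - {i}. C $ i $ j * matrix_inv C $ j $ i)"
    by (simp add: sum.remove[of UNIV i])
  also have "\<dots> \<le> C $ i $ i * matrix_inv C $ i $ i"
    using Z nn' by (auto intro!: sum_nonpos mult_nonpos_nonneg)
  finally show ?thesis
    using nn'[of i i] by (smt (verit) mult_nonpos_nonneg)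
qed

text \<open>The bound is read off at an index maximising \<open>\<bar>d\<^sub>i\<bar> / v\<^sub>i\<close>.\<close>
lemma comparison_matrix_bound:
  fixes C :: "real^'n^'n" and d v :: "real^'n"
  assumes v: "\<And>i. 0 < v $ i"
    and Cv: "\<And>i. 0 < (\<langle>C\<rangle> *v v) $ i"
    and le: "\<bar>C *v d\<bar> \<le> s *\<^sub>R (\<langle>C\<rangle> *v v)"
  shows "\<bar>d\<bar> \<le> s *\<^sub>R v"
proof -
  define t where "t = Max (range (\<lambda>i. \<bar>d $ i\<bar> / v $ i))"
  have "t \<in> range (\<lambda>i. \<bar>d $ i\<bar> / v $ i)"
    unfolding t_def by (intro Max_in) auto
  then obtain i where i: "t = \<bar>d $ i\<bar> / v $ i" by auto
  have "\<bar>d $ j\<bar> / v $ j \<le> t" for j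
    unfolding t_def by (intro Max_ge) auto
  then have t: "\<bar>d $ j\<bar> \<le> t * v $ j" for j
    using v[of j] by (simp add: divide_le_eq)
  have di: "\<bar>d $ i\<bar> = t * v $ i" using i v[of i] by simp
  \<comment> \<open>At the maximising index the diagonal term is exact, because
    \<open>\<bar>d $ i\<bar> = t * v $ i\<close>, while the off-diagonal terms are over-estimated by
    \<open>t\<close>. The reverse triangle inequality then leads to row \<open>i\<close> of
    \<open>C *v d\<close>.\<close>
  have "t * (\<langle>C\<rangle> *v v) $ i
      = \<bar>C $ i $ i\<bar> * \<bar>d $ i\<bar> - (\<Sum>j\<in>UNIV - {i}. \<bar>C $ i $ j\<bar> * (t * v $ j))"
    unfolding matrix_vector_mult_def comparison_matrix_def di
    by (simp add: sum.remove[of UNIV i] sum_distrib_left sum_negf algebra_simps)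
  also have "\<dots> \<le> \<bar>C $ i $ i * d $ i\<bar> - (\<Sum>j\<in>UNIV - {i}. \<bar>C $ i $ j * d $ j\<bar>)"
    by (auto simp: abs_mult intro!: sum_mono mult_left_mono t)
  also have "\<dots> \<le> \<bar>C $ i $ i * d $ i\<bar> - \<bar>\<Sum>j\<in>UNIV - {i}. C $ i $ j * d $ j\<bar>"
    by simp
  also have "\<dots> \<le> \<bar>C $ i $ i * d $ i + (\<Sum>j\<in>UNIV - {i}. C $ i $ j * d $ j)\<bar>"
    by simp
  also have "\<dots> = \<bar>C *v d\<bar> $ i"
    unfolding matrix_vector_mult_def abs_vec_def by (simp add: sum.remove[of UNIV i])
  also have "\<dots> \<le> s * (\<langle>C\<rangle> *v v) $ i"
    using le unfolding less_eq_vec_def by auto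
  finally have "t \<le> s" using Cv[of i] by simp
  then have "\<bar>d $ j\<bar> \<le> s * v $ j" for j
    using t[of j] v[of j] by (meson less_imp_le mult_right_mono order_trans)
  then show ?thesis unfolding less_eq_vec_def abs_vec_def by simp
qed

text \<open>A positive \<open>v\<close> with \<open>\<langle>C\<rangle> *v v\<close> positive
  expresses generalized diagonal dominance. The preceding bound with \<open>s = 0\<close> shows that
  the kernel is trivial.\<close>

lemma invertible_if_comparison_matrix_pos:
  fixes C :: "real^'n^'n"
  assumes v: "\<And>i. 0 < v $ i" and Cv: "\<And>i. 0 < (\<langle>C\<rangle> *v v) $ i"
  shows "invertible C"
proof -
  have "d = 0" if "C *v d = 0" for d
    using comparison_matrix_bound[OF v Cv, of d 0] that
    by (simp add: less_eq_vec_def abs_vec_def vec_eq_iff)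
  then show ?thesis
    using matrix_left_invertible_ker invertible_left_inverse by blast
qed

section \<open>Contraction in a weighted maximum norm\<close>

lemma uniform_factor_lt_one:
  fixes f g :: "real^'n"
  assumes "\<And>i. 0 \<le> f $ i" "\<And>i. f $ i < g $ i"
  obtains \<theta> where "0 \<le> \<theta>" "\<theta> < 1" "f \<le> \<theta> *\<^sub>R g"
proof
  \<comment> \<open>The index type is finite, so the largest quotient is attained and inherits
    strictness from a single component.\<close>
  define \<theta> where "\<theta> = Max (range (\<lambda>i. f $ i / g $ i))"
  have g: "0 < g $ i" for i using assms[of i] by linarith
  have "\<theta> \<in> range (\<lambda>i. f $ i / g $ i)"
    unfolding \<theta>_def by (intro Max_in) auto
  then obtain i where i: "\<theta> = f $ i / g $ i" by auto
  show "0 \<le> \<theta>" "\<theta> < 1" unfolding i using assms[of i] g[of i] by (auto simp: divide_less_eq)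
  have "f $ j / g $ j \<le> \<theta>" for j
    unfolding \<theta>_def by (intro Max_ge) auto
  then show "f \<le> \<theta> *\<^sub>R g"
    using g by (auto simp: less_eq_vec_def divide_le_eq)
qed

text \<open>The inequality \<open>\<bar>x k - l\<bar> \<le> s *\<^sub>R v\<close> says that the
  error has weighted maximum norm at most \<open>s\<close>. Starting from the norm of the initial
  error, the bounds decay geometrically, and each component is squeezed.\<close>

lemma tendsto_if_weighted_contraction:
  fixes x :: "nat \<Rightarrow> real^'n"
  assumes v: "\<And>i. 0 < v $ i"
    and \<theta>: "0 \<le> \<theta>" "\<theta> < 1"
    and step: "\<And>k s. 0 \<le> s \<Longrightarrow> \<bar>x k - l\<bar> \<le> s *\<^sub>R v \<Longrightarrow> \<bar>x (Suc k) - l\<bar> \<le> (s * \<theta>) *\<^sub>R v"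
  shows "x \<longlonglongrightarrow> l"
proof -
  define s where "s = Max (range (\<lambda>i. \<bar>x 0 $ i - l $ i\<bar> / v $ i))"
  have s: "\<bar>x 0 $ i - l $ i\<bar> / v $ i \<le> s" for i
    unfolding s_def by (intro Max_ge) auto
  have s0: "0 \<le> s"
    by (rule order_trans[OF _ s]) (simp add: less_imp_le v)
  have bound: "\<bar>x k - l\<bar> \<le> (s * \<theta> ^ k) *\<^sub>R v" for k
  proof (induction k)
    case 0
    then show ?case using s v by (simp add: less_eq_vec_def abs_vec_def divide_le_eq)
  next
    case (Suc k)
    then show ?case using step[of "s * \<theta> ^ k" k] s0 \<theta> by (simp add: mult_ac)
  qed
  have "(\<lambda>k. x k $ i) \<longlonglongrightarrow> l $ i" for i
  proof (rule LIM_zero_cancel, rule tendsto_rabs_zero_cancel)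
    have lim: "(\<lambda>k. s * \<theta> ^ k * v $ i) \<longlonglongrightarrow> 0"
      using \<theta> by (auto intro!: tendsto_mult_left_zero tendsto_mult_right_zero LIMSEQ_power_zero)
    have "\<bar>x k $ i - l $ i\<bar> \<le> s * \<theta> ^ k * v $ i" for k
      using bound[of k] by (simp add: less_eq_vec_def abs_vec_def)
    then show "(\<lambda>k. \<bar>x k $ i - l $ i\<bar>) \<longlonglongrightarrow> 0"
      by (intro tendsto_sandwich[OF _ _ tendsto_const lim]) auto
  qed
  then show ?thesis by (rule vec_tendstoI)
qed

section \<open>The fixed point and the error of one iteration step\<close>

text \<open>Invertibility makes the definite description meaningful and turns it into an explicit
  expression, from which continuity in \<open>x\<close> can be read off.\<close>

lemma NRMAOR_z_of_eq:
  assumes "invertible A"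
  shows "NRMAOR_z_of A q \<Omega>\<^sub>2 \<gamma> x = matrix_inv A *v ((1 / \<gamma>) *\<^sub>R (\<Omega>\<^sub>2 *v (\<bar>x\<bar> - x)) - q)"
proof -
  have 1: "A *v (matrix_inv A *v y) = y" "matrix_inv A *v (A *v y) = y" for y
    using assms by (simp_all add: matrix_vector_mul_assoc matrix_inv)
  show ?thesis unfolding NRMAOR_z_of_def by (rule the_equality) (use 1 in metis)+
qed

text \<open>
  The matrix \<open>inf 0 (\<Omega>\<^sub>2 - D \<Omega>\<^sub>1)\<close> vanishes under condition (1) and equals \<open>\<Omega>\<^sub>2 - D \<Omega>\<^sub>1\<close> under
  condition (2).
\<close>
lemma comparison_matrix_NRMAOR_le:
  fixes M N \<Omega>\<^sub>1 \<Omega>\<^sub>2 :: "real^'n^'n"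
  assumes \<Omega>\<^sub>1: "positive_diagonal_matrix \<Omega>\<^sub>1" and \<Omega>\<^sub>2: "positive_diagonal_matrix \<Omega>\<^sub>2"
    and M: "\<And>i. 0 < M $ i $ i"
  shows "2 *\<^sub>R (inf 0 (\<Omega>\<^sub>2 - diag_part (M - N) ** \<Omega>\<^sub>1) + \<langle>M ** \<Omega>\<^sub>1\<rangle> - \<bar>N ** \<Omega>\<^sub>1\<bar>)
    \<le> \<langle>\<Omega>\<^sub>2 + M ** \<Omega>\<^sub>1\<rangle> - \<bar>N ** \<Omega>\<^sub>1\<bar> - \<bar>\<Omega>\<^sub>2 - (M - N) ** \<Omega>\<^sub>1\<bar>"
proof -
  have d: "diagonal_matrix \<Omega>\<^sub>1" and p: "\<And>i. 0 < \<Omega>\<^sub>1 $ i $ i" "\<And>i. 0 < \<Omega>\<^sub>2 $ i $ i"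
    and o: "\<And>i j. i \<noteq> j \<Longrightarrow> \<Omega>\<^sub>2 $ i $ j = 0"
    using assms unfolding positive_diagonal_matrix_def diagonal_matrix_def by auto
  have Mp: "0 < M $ i $ i * \<Omega>\<^sub>1 $ i $ i" for i using M p by simp
  \<comment> \<open>Since \<open>a\<close> and \<open>w\<close> are positive,
    \<open>\<bar>w + a\<bar> = w + a\<close>. On either side of \<open>w = a - b\<close> the
    right-hand side exceeds the left by exactly \<open>\<bar>b\<bar> - b\<close>.\<close>
  have diag: "2 * (min 0 (w - (a - b)) + \<bar>a\<bar> - \<bar>b\<bar>) \<le> \<bar>w + a\<bar> - \<bar>b\<bar> - \<bar>w - (a - b)\<bar>"
    if "0 < a" "0 < w" for a b w :: real
    using that by (auto simp: min_def abs_if)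
  \<comment> \<open>Off the diagonal the entries of \<open>\<Omega>\<^sub>2\<close> and of the
    \<open>inf\<close> term vanish, and the triangle inequality remains.\<close>
  have off: "2 * (- \<bar>a\<bar> - \<bar>b\<bar>) \<le> - \<bar>a\<bar> - \<bar>b\<bar> - \<bar>b - a\<bar>" for a b :: real
    by (simp add: abs_if)
  show ?thesis
    unfolding less_eq_vec_def
  proof (intro allI)
    fix i j
    show "(2 *\<^sub>R (inf 0 (\<Omega>\<^sub>2 - diag_part (M - N) ** \<Omega>\<^sub>1) + \<langle>M ** \<Omega>\<^sub>1\<rangle> - \<bar>N ** \<Omega>\<^sub>1\<bar>)) $ i $ j
      \<le> (\<langle>\<Omega>\<^sub>2 + M ** \<Omega>\<^sub>1\<rangle> - \<bar>N ** \<Omega>\<^sub>1\<bar> - \<bar>\<Omega>\<^sub>2 - (M - N) ** \<Omega>\<^sub>1\<bar>) $ i $ j"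
      using diag[OF Mp p(2), of i i "N $ i $ i * \<Omega>\<^sub>1 $ i $ i"]
        off[of "M $ i $ j * \<Omega>\<^sub>1 $ j $ j" "N $ i $ j * \<Omega>\<^sub>1 $ j $ j"] o[of i j]
      by (cases "i = j")
        (simp_all add: comparison_matrix_def diagonal_matrix_mult_right[OF d] inf_vec_def
          inf_real_def abs_vec_def diag_part_def left_diff_distrib)
  qed
qed

text \<open>By complementarity the nonnegative vectors \<open>z - \<zeta> z\<close> and
  \<open>A *v z + q\<close> have disjoint supports. Suitably scaled, they are therefore the positive
  and negative parts of one vector \<open>x\<close>, and \<open>\<bar>x\<bar> + x\<close> and
  \<open>\<bar>x\<bar> - x\<close> are twice these parts.\<close>

lemma ICP_solution_modulus:
  assumes \<Omega>\<^sub>1: "positive_diagonal_matrix \<Omega>\<^sub>1" and \<Omega>\<^sub>2: "positive_diagonal_matrix \<Omega>\<^sub>2"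
    and \<gamma>: "0 < \<gamma>" and sol: "ICP_solution q A \<zeta> z"
  obtains x where "\<Omega>\<^sub>1 *v (\<bar>x\<bar> + x) = \<gamma> *\<^sub>R (z - \<zeta> z)" "\<Omega>\<^sub>2 *v (\<bar>x\<bar> - x) = \<gamma> *\<^sub>R (A *v z + q)"
proof
  define w r where "w = z - \<zeta> z" and "r = A *v z + q"
  define x where "x = (\<chi> i. \<gamma> / 2 * (w $ i / \<Omega>\<^sub>1 $ i $ i - r $ i / \<Omega>\<^sub>2 $ i $ i))"
  have d: "diagonal_matrix \<Omega>\<^sub>1" "diagonal_matrix \<Omega>\<^sub>2"
    and p: "\<And>i. 0 < \<Omega>\<^sub>1 $ i $ i" "\<And>i. 0 < \<Omega>\<^sub>2 $ i $ i"
    using \<Omega>\<^sub>1 \<Omega>\<^sub>2 unfolding positive_diagonal_matrix_def by auto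
  have wr: "0 \<le> w $ i" "0 \<le> r $ i" for i
    using sol unfolding ICP_solution_def w_def r_def less_eq_vec_def by auto
  have "(\<Sum>i\<in>UNIV. w $ i * r $ i) = 0"
    using sol unfolding ICP_solution_def w_def[symmetric] r_def[symmetric] inner_vec_def by simp
  then have comp: "w $ i = 0 \<or> r $ i = 0" for i
    using wr by (simp add: sum_nonneg_eq_0_iff)
  \<comment> \<open>One of the two summands is zero, so the absolute value of their difference is
    their sum.\<close>
  have absx: "\<bar>x $ i\<bar> = \<gamma> / 2 * (w $ i / \<Omega>\<^sub>1 $ i $ i + r $ i / \<Omega>\<^sub>2 $ i $ i)" for i
    using comp[of i] wr[of i] p[of i] \<gamma> by (auto simp: x_def abs_mult)
  have *: "\<Omega>\<^sub>1 $ i $ i * (\<bar>x $ i\<bar> + x $ i) = \<gamma> * w $ i"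
    "\<Omega>\<^sub>2 $ i $ i * (\<bar>x $ i\<bar> - x $ i) = \<gamma> * r $ i" for i
    unfolding absx using p[of i] by (simp_all add: x_def field_simps)
  show "\<Omega>\<^sub>1 *v (\<bar>x\<bar> + x) = \<gamma> *\<^sub>R (z - \<zeta> z)" "\<Omega>\<^sub>2 *v (\<bar>x\<bar> - x) = \<gamma> *\<^sub>R (A *v z + q)"
    unfolding w_def[symmetric] r_def[symmetric] vec_eq_iff diagonal_matrix_mult_vec[OF d(1)]
      diagonal_matrix_mult_vec[OF d(2)]
    using * by (simp_all add: abs_vec_def)
qed

text \<open>Here \<open>M\<close> and \<open>N\<close> stand for the matrices already shifted by
  \<phi>. The fixed-point equation of \<open>x\<close> is subtracted from the step equation of
  \<open>y'\<close>, and the three resulting terms are estimated separately.\<close>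

lemma NRMAOR_error_bound:
  fixes A M N \<Psi> \<Omega>\<^sub>1 \<Omega>\<^sub>2 :: "real^'n^'n" and \<zeta> :: "real^'n \<Rightarrow> real^'n"
  assumes A: "A = M - N" and invA: "invertible A"
    and \<Omega>\<^sub>2: "0 \<le> \<Omega>\<^sub>2" and \<gamma>: "0 < \<gamma>" and \<Psi>_nonneg: "0 \<le> \<Psi>"
    and \<zeta>: "\<And>x y. \<bar>\<zeta> x - \<zeta> y\<bar> \<le> \<Psi> *v \<bar>x - y\<bar>"
    and fix1: "\<Omega>\<^sub>1 *v (\<bar>x\<bar> + x) = \<gamma> *\<^sub>R (z - \<zeta> z)"
    and fix2: "\<Omega>\<^sub>2 *v (\<bar>x\<bar> - x) = \<gamma> *\<^sub>R (A *v z + q)"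
    and z': "A *v z' = (1 / \<gamma>) *\<^sub>R (\<Omega>\<^sub>2 *v (\<bar>y\<bar> - y)) - q"
    and y': "(\<Omega>\<^sub>2 + M ** \<Omega>\<^sub>1) *v y' = (N ** \<Omega>\<^sub>1) *v y + (\<Omega>\<^sub>2 - A ** \<Omega>\<^sub>1) *v \<bar>y\<bar>
      - \<gamma> *\<^sub>R (A *v \<zeta> z') - \<gamma> *\<^sub>R q"
  shows "\<bar>(\<Omega>\<^sub>2 + M ** \<Omega>\<^sub>1) *v (y' - x)\<bar>
    \<le> (\<bar>N ** \<Omega>\<^sub>1\<bar> + \<bar>\<Omega>\<^sub>2 - A ** \<Omega>\<^sub>1\<bar> + 2 *\<^sub>R (\<bar>A\<bar> ** \<Psi> ** \<bar>matrix_inv A\<bar> ** \<Omega>\<^sub>2)) *v \<bar>y - x\<bar>"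
proof -
  let ?d = "\<bar>y - x\<bar>"
  let ?c = "(\<bar>y\<bar> - \<bar>x\<bar>) - (y - x)"
  let ?g = "\<gamma> *\<^sub>R (\<zeta> z' - \<zeta> z)"
  have abs_eq: "\<bar>\<Omega>\<^sub>2\<bar> = \<Omega>\<^sub>2" "\<bar>\<Psi>\<bar> = \<Psi>" using \<Omega>\<^sub>2 \<Psi>_nonneg by simp_all
  \<comment> \<open>Subtracting the equations for \<open>z'\<close> and \<open>z\<close> eliminates
    \<open>q\<close> and expresses \<open>\<gamma> *\<^sub>R (z' - z)\<close> through
    \<open>?c\<close>.\<close>
  have "\<gamma> *\<^sub>R (A *v z') = \<Omega>\<^sub>2 *v (\<bar>y\<bar> - y) - \<gamma> *\<^sub>R q"
    using \<gamma> by (simp add: z' scaleR_right_diff_distrib)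
  moreover have "\<gamma> *\<^sub>R (A *v z) = \<Omega>\<^sub>2 *v (\<bar>x\<bar> - x) - \<gamma> *\<^sub>R q"
    by (simp add: fix2 scaleR_right_distrib)
  ultimately have Az: "A *v (\<gamma> *\<^sub>R (z' - z)) = \<Omega>\<^sub>2 *v ?c"
    by (simp add: matrix_vector_mult_scaleR matrix_vector_mult_diff_distrib
        scaleR_right_diff_distrib)
  have "\<gamma> *\<^sub>R (z' - z) = matrix_inv A *v (A *v (\<gamma> *\<^sub>R (z' - z)))"
    by (simp add: matrix_vector_mul_assoc matrix_inv[OF invA])
  then have z: "\<gamma> *\<^sub>R (z' - z) = matrix_inv A *v (\<Omega>\<^sub>2 *v ?c)"
    by (simp only: Az)
  have abs_diff: "\<bar>\<bar>y\<bar> - \<bar>x\<bar>\<bar> \<le> ?d" by (rule abs_triangle_ineq3)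
  \<comment> \<open>The factor 2 of the \<Psi>-term arises here: \<open>y - x\<close> and
    \<open>\<bar>y\<bar> - \<bar>x\<bar>\<close> each contribute one copy of
    \<open>?d\<close>.\<close>
  have "\<bar>?c\<bar> \<le> \<bar>\<bar>y\<bar> - \<bar>x\<bar>\<bar> + ?d" by (rule abs_triangle_ineq4)
  also have "\<dots> \<le> 2 *\<^sub>R ?d" using abs_diff by (simp only: scaleR_2 add_right_mono)
  finally have "\<bar>\<Omega>\<^sub>2 *v ?c\<bar> \<le> \<Omega>\<^sub>2 *v (2 *\<^sub>R ?d)"
    using abs_matrix_vector_mult_bound[of ?c _ \<Omega>\<^sub>2] by (simp add: abs_eq)
  then have "\<bar>\<gamma> *\<^sub>R (z' - z)\<bar> \<le> \<bar>matrix_inv A\<bar> *v (\<Omega>\<^sub>2 *v (2 *\<^sub>R ?d))"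
    unfolding z by (rule abs_matrix_vector_mult_bound)
  then have "\<Psi> *v \<bar>\<gamma> *\<^sub>R (z' - z)\<bar> \<le> \<Psi> *v (\<bar>matrix_inv A\<bar> *v (\<Omega>\<^sub>2 *v (2 *\<^sub>R ?d)))"
    using \<Psi>_nonneg by (intro matrix_vector_mult_mono) auto
  moreover have "\<bar>?g\<bar> \<le> \<Psi> *v \<bar>\<gamma> *\<^sub>R (z' - z)\<bar>"
    using scaleR_left_mono[OF \<zeta>[of z' z], of \<gamma>] \<gamma>
    by (simp add: less_eq_vec_def abs_vec_def abs_mult matrix_vector_mult_def sum_distrib_left
        mult.left_commute)
  ultimately have g: "\<bar>A *v ?g\<bar> \<le> \<bar>A\<bar> *v (\<Psi> *v (\<bar>matrix_inv A\<bar> *v (\<Omega>\<^sub>2 *v (2 *\<^sub>R ?d))))"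
    using abs_matrix_vector_mult_bound order_trans by blast
  \<comment> \<open>With \<open>A = M - N\<close> the terms regroup into the two modulus relations.
    Their contributions \<open>A *v z\<close> cancel, so \<open>x\<close> satisfies the step
    equation with \<open>\<zeta> z\<close> in place of \<open>\<zeta> z'\<close>.\<close>
  have "(\<Omega>\<^sub>2 + M ** \<Omega>\<^sub>1) *v x - (N ** \<Omega>\<^sub>1) *v x - (\<Omega>\<^sub>2 - A ** \<Omega>\<^sub>1) *v \<bar>x\<bar>
    = A *v (\<Omega>\<^sub>1 *v (\<bar>x\<bar> + x)) - \<Omega>\<^sub>2 *v (\<bar>x\<bar> - x)"
    unfolding A by (simp add: algebra_simps flip: matrix_vector_mul_assoc)
  also have "\<dots> = - \<gamma> *\<^sub>R (A *v \<zeta> z) - \<gamma> *\<^sub>R q"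
    unfolding fix1 fix2 by (simp add: algebra_simps)
  finally have "(\<Omega>\<^sub>2 + M ** \<Omega>\<^sub>1) *v x
    = (N ** \<Omega>\<^sub>1) *v x + (\<Omega>\<^sub>2 - A ** \<Omega>\<^sub>1) *v \<bar>x\<bar> - \<gamma> *\<^sub>R (A *v \<zeta> z) - \<gamma> *\<^sub>R q"
    by (simp add: algebra_simps)
  then have "(\<Omega>\<^sub>2 + M ** \<Omega>\<^sub>1) *v (y' - x)
    = (N ** \<Omega>\<^sub>1) *v (y - x) + (\<Omega>\<^sub>2 - A ** \<Omega>\<^sub>1) *v (\<bar>y\<bar> - \<bar>x\<bar>) - A *v ?g"
    by (simp only: matrix_vector_mult_diff_distrib y' matrix_vector_mult_scaleR
        scaleR_right_diff_distrib) simp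
  also have "\<bar>\<dots>\<bar> \<le> \<bar>(N ** \<Omega>\<^sub>1) *v (y - x)\<bar> + \<bar>(\<Omega>\<^sub>2 - A ** \<Omega>\<^sub>1) *v (\<bar>y\<bar> - \<bar>x\<bar>)\<bar> + \<bar>A *v ?g\<bar>"
    by (intro order_trans[OF abs_triangle_ineq4] add_right_mono abs_triangle_ineq)
  also have "\<dots> \<le> \<bar>N ** \<Omega>\<^sub>1\<bar> *v ?d + \<bar>\<Omega>\<^sub>2 - A ** \<Omega>\<^sub>1\<bar> *v ?d
      + \<bar>A\<bar> *v (\<Psi> *v (\<bar>matrix_inv A\<bar> *v (\<Omega>\<^sub>2 *v (2 *\<^sub>R ?d))))"
    by (intro add_mono g abs_matrix_vector_mult_bound abs_diff order_refl)
  also have "\<dots> = (\<bar>N ** \<Omega>\<^sub>1\<bar> + \<bar>\<Omega>\<^sub>2 - A ** \<Omega>\<^sub>1\<bar>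
      + 2 *\<^sub>R (\<bar>A\<bar> ** \<Psi> ** \<bar>matrix_inv A\<bar> ** \<Omega>\<^sub>2)) *v ?d"
    by (simp add: matrix_vector_mult_add_rdistrib matrix_vector_mult_scaleR
        scaleR_matrix_vector_assoc[symmetric] flip: matrix_vector_mul_assoc)
  finally show ?thesis .
qed

section \<open>Convergence of the iterates to the solution\<close>

theorem theorem4p4:
  fixes A D L U M N \<Omega>\<^sub>1 \<Omega>\<^sub>2 \<phi> \<Psi> :: "real^'n::{finite,linorder}^'n::{finite,linorder}"
    and q zstar x0 e :: "real^'n::{finite,linorder}"
    and \<zeta> :: "real^'n::{finite,linorder} \<Rightarrow> real^'n::{finite,linorder}"
    and \<alpha> \<beta> \<gamma> :: real
  assumes A: "H_plus_matrix A"
    and D: "D = diag_part A" and L: "L = lower_part A" and U: "U = upper_part A"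
    and \<gamma>: "0 < \<gamma>"
    and solution: "ICP_solution q A \<zeta> zstar"
    and unique: "\<And>z. ICP_solution q A \<zeta> z \<Longrightarrow> z = zstar"
    and \<Psi>_nonneg: "0 \<le> \<Psi>"
    and \<zeta>: "\<And>x y. \<bar>\<zeta> x - \<zeta> y\<bar> \<le> \<Psi> *v \<bar>x - y\<bar>"
    and \<Omega>\<^sub>1: "positive_diagonal_matrix \<Omega>\<^sub>1"
    and \<Omega>\<^sub>2: "positive_diagonal_matrix \<Omega>\<^sub>2"
    and \<phi>: "diagonal_matrix \<phi>"
    and \<alpha>: "\<alpha> \<noteq> 0"
    and M: "M = (1 / \<alpha>) *\<^sub>R (D - \<beta> *\<^sub>R L)"
    and N: "N = (1 / \<alpha>) *\<^sub>R ((1 - \<alpha>) *\<^sub>R D + (\<alpha> - \<beta>) *\<^sub>R L + \<alpha> *\<^sub>R U)"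
    and nonsing: "invertible (\<Omega>\<^sub>2 + M ** \<Omega>\<^sub>1 + \<phi> ** \<Omega>\<^sub>1)"
    and splitting: "H_splitting A (M + \<phi>) (N + \<phi>)"
    and e: "e = (\<chi> i. 1)"
    and conditions: "\<exists>V. positive_diagonal_matrix V
      \<and> strictly_diagonally_dominant ((\<langle>M + \<phi>\<rangle> - \<bar>N + \<phi>\<bar>) ** V)
      \<and> ((D ** \<Omega>\<^sub>1 \<le> \<Omega>\<^sub>2
           \<and> (\<forall>i. 0 < (((\<langle>M ** \<Omega>\<^sub>1 + \<phi> ** \<Omega>\<^sub>1\<rangle> - \<bar>N ** \<Omega>\<^sub>1 + \<phi> ** \<Omega>\<^sub>1\<bar>
                        - \<bar>A\<bar> ** \<Psi> ** \<bar>matrix_inv A\<bar> ** \<Omega>\<^sub>2) ** V) *v e) $ i))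
         \<or> ((\<forall>i. 0 < \<Omega>\<^sub>2 $ i $ i \<and> \<Omega>\<^sub>2 $ i $ i < (D ** \<Omega>\<^sub>1) $ i $ i)
           \<and> (\<forall>i. 0 < (((\<Omega>\<^sub>2 - D ** \<Omega>\<^sub>1 + \<langle>M ** \<Omega>\<^sub>1 + \<phi> ** \<Omega>\<^sub>1\<rangle>
                        - \<bar>N ** \<Omega>\<^sub>1 + \<phi> ** \<Omega>\<^sub>1\<bar>
                        - \<bar>A\<bar> ** \<Psi> ** \<bar>matrix_inv A\<bar> ** \<Omega>\<^sub>2) ** V) *v e) $ i)))"
  shows "NRMAOR_z A M N \<phi> \<Omega>\<^sub>1 \<Omega>\<^sub>2 \<gamma> q \<zeta> x0 \<longlonglongrightarrow> zstar"
proof -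
  define M' N' where "M' = M + \<phi>" and "N' = N + \<phi>"
  define P where "P = \<Omega>\<^sub>2 + M' ** \<Omega>\<^sub>1"
  define K where "K = \<bar>A\<bar> ** \<Psi> ** \<bar>matrix_inv A\<bar> ** \<Omega>\<^sub>2"
  define R where "R = \<bar>N' ** \<Omega>\<^sub>1\<bar> + \<bar>\<Omega>\<^sub>2 - A ** \<Omega>\<^sub>1\<bar> + 2 *\<^sub>R K"
  \<comment> \<open>The \<open>inf\<close> term merges the two alternatives into one statement, the
    positivity of \<open>T *v v\<close>.\<close>
  define T where "T = inf 0 (\<Omega>\<^sub>2 - D ** \<Omega>\<^sub>1) + \<langle>M' ** \<Omega>\<^sub>1\<rangle> - \<bar>N' ** \<Omega>\<^sub>1\<bar> - K"
  have fold: "M ** \<Omega>\<^sub>1 + \<phi> ** \<Omega>\<^sub>1 = M' ** \<Omega>\<^sub>1" "N ** \<Omega>\<^sub>1 + \<phi> ** \<Omega>\<^sub>1 = N' ** \<Omega>\<^sub>1"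
    "\<Omega>\<^sub>2 + M ** \<Omega>\<^sub>1 + \<phi> ** \<Omega>\<^sub>1 = P"
    by (simp_all add: M'_def N'_def P_def matrix_add_rdistrib add.assoc)
  have A_eq: "A = M' - N'" and W: "M_matrix (\<langle>M'\<rangle> - \<bar>N'\<bar>)"
    using splitting unfolding H_splitting_def M'_def N'_def by auto
  have A_pos: "0 < A $ i $ i" for i using A unfolding H_plus_matrix_def by auto
  \<comment> \<open>The M-matrix property gives
    \<open>\<bar>M' $ i $ i\<bar> > \<bar>N' $ i $ i\<bar>\<close>. As the difference
    \<open>M' $ i $ i - N' $ i $ i = A $ i $ i\<close> is positive, \<open>M' $ i $ i\<close> cannot
    be negative or zero.\<close>
  have M'_pos: "0 < M' $ i $ i" for i
    using M_matrix_diagonal_pos[OF W, of i] A_pos[of i]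
    by (simp add: A_eq comparison_matrix_def abs_vec_def)
  have d1: "diagonal_matrix \<Omega>\<^sub>1" and p1: "\<And>i. 0 < \<Omega>\<^sub>1 $ i $ i"
    and d2: "diagonal_matrix \<Omega>\<^sub>2"
    using \<Omega>\<^sub>1 \<Omega>\<^sub>2 unfolding positive_diagonal_matrix_def by auto
  note nonneg2 = positive_diagonal_matrix_nonneg[OF \<Omega>\<^sub>2]
  have K: "0 \<le> K"
    unfolding K_def by (intro matrix_mult_nonneg abs_ge_zero \<Psi>_nonneg nonneg2)
  obtain V where V: "positive_diagonal_matrix V" and
    cond: "(D ** \<Omega>\<^sub>1 \<le> \<Omega>\<^sub>2
        \<and> (\<forall>i. 0 < (((\<langle>M' ** \<Omega>\<^sub>1\<rangle> - \<bar>N' ** \<Omega>\<^sub>1\<bar> - K) ** V) *v e) $ i))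
      \<or> ((\<forall>i. 0 < \<Omega>\<^sub>2 $ i $ i \<and> \<Omega>\<^sub>2 $ i $ i < (D ** \<Omega>\<^sub>1) $ i $ i)
        \<and> (\<forall>i. 0 < (((\<Omega>\<^sub>2 - D ** \<Omega>\<^sub>1 + \<langle>M' ** \<Omega>\<^sub>1\<rangle> - \<bar>N' ** \<Omega>\<^sub>1\<bar> - K) ** V) *v e) $ i))"
    using conditions unfolding fold K_def[symmetric] by blast
  define v where "v = V *v e"
  have v: "0 < v $ i" for i
    using V unfolding v_def e positive_diagonal_matrix_def by (simp add: diagonal_matrix_mult_vec)
  have v0: "0 \<le> v" using v by (simp add: less_eq_vec_def less_imp_le)
  have Tv: "0 < (T *v v) $ i" for i
    using cond
  proof (elim disjE conjE)
    assume "D ** \<Omega>\<^sub>1 \<le> \<Omega>\<^sub>2"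
    then have "inf 0 (\<Omega>\<^sub>2 - D ** \<Omega>\<^sub>1) = 0" by (simp add: inf_absorb1)
    moreover assume "\<forall>i. 0 < (((\<langle>M' ** \<Omega>\<^sub>1\<rangle> - \<bar>N' ** \<Omega>\<^sub>1\<bar> - K) ** V) *v e) $ i"
    ultimately show ?thesis by (simp add: T_def v_def matrix_vector_mul_assoc)
  next
    assume lt: "\<forall>i. 0 < \<Omega>\<^sub>2 $ i $ i \<and> \<Omega>\<^sub>2 $ i $ i < (D ** \<Omega>\<^sub>1) $ i $ i"
    have "\<Omega>\<^sub>2 $ i $ j \<le> (D ** \<Omega>\<^sub>1) $ i $ j" for i j
      using lt d2 by (cases "i = j")
        (auto simp: diagonal_matrix_mult_right[OF d1] D diag_part_def diagonal_matrix_def less_imp_le)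
    then have "\<Omega>\<^sub>2 - D ** \<Omega>\<^sub>1 \<le> 0" by (simp add: less_eq_vec_def)
    then have "inf 0 (\<Omega>\<^sub>2 - D ** \<Omega>\<^sub>1) = \<Omega>\<^sub>2 - D ** \<Omega>\<^sub>1" by (simp only: inf_absorb2)
    moreover assume
      "\<forall>i. 0 < (((\<Omega>\<^sub>2 - D ** \<Omega>\<^sub>1 + \<langle>M' ** \<Omega>\<^sub>1\<rangle> - \<bar>N' ** \<Omega>\<^sub>1\<bar> - K) ** V) *v e) $ i"
    ultimately show ?thesis by (simp add: T_def v_def matrix_vector_mul_assoc)
  qed
  have mono: "(B *v v) $ i \<le> (C *v v) $ i" if "B \<le> C"
    for i and B C :: "real^'n::{finite,linorder}^'n::{finite,linorder}"
    using matrix_vector_mult_mono_left[OF that v0] unfolding less_eq_vec_def by blast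
  \<comment> \<open>Subtracting \<open>2 *\<^sub>R K\<close> on both sides of the entrywise
    comparison matches the factor 2 of \<open>K\<close> in \<open>R\<close>.\<close>
  have "2 *\<^sub>R T \<le> \<langle>P\<rangle> - R"
    using comparison_matrix_NRMAOR_le[OF \<Omega>\<^sub>1 \<Omega>\<^sub>2 M'_pos, of N']
    unfolding A_eq[symmetric] D[symmetric] P_def[symmetric] T_def R_def
    by (simp add: algebra_simps)
  then have "(R *v v) $ i + 2 * (T *v v) $ i \<le> (\<langle>P\<rangle> *v v) $ i" for i
    using mono[of "2 *\<^sub>R T" "\<langle>P\<rangle> - R" i]
    by (simp add: matrix_vector_mult_diff_rdistrib flip: scaleR_matrix_vector_assoc)
  then have key: "(R *v v) $ i < (\<langle>P\<rangle> *v v) $ i" for i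
    using Tv[of i] by (smt (verit))
  have R: "0 \<le> R"
    unfolding R_def by (intro add_nonneg_nonneg scaleR_nonneg_nonneg K abs_ge_zero) simp
  have Rv: "0 \<le> (R *v v) $ i" for i
    using mono[OF R, of i] by simp
  have Pv: "0 < (\<langle>P\<rangle> *v v) $ i" for i
    using key[of i] Rv[of i] by linarith
  obtain \<theta> where \<theta>: "0 \<le> \<theta>" "\<theta> < 1" "R *v v \<le> \<theta> *\<^sub>R (\<langle>P\<rangle> *v v)"
    using uniform_factor_lt_one[of "R *v v" "\<langle>P\<rangle> *v v"] Rv key by blast
  \<comment> \<open>The positive vector for \<open>\<langle>A\<rangle>\<close> is
    \<open>\<Omega>\<^sub>1 *v v\<close>: dropping the nonpositive contributions of the
    \<open>inf\<close> term and of \<open>- K\<close> gives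
    \<open>T \<le> \<langle>A\<rangle> ** \<Omega>\<^sub>1\<close>, and \<open>T *v v\<close> is
    positive.\<close>
  have invA: "invertible A"
  proof (rule invertible_if_comparison_matrix_pos)
    show "0 < (\<Omega>\<^sub>1 *v v) $ i" for i
      using p1 v by (simp add: diagonal_matrix_mult_vec[OF d1])
    have entry: "T $ i $ j \<le> (\<langle>A\<rangle> ** \<Omega>\<^sub>1) $ i $ j" for i j
    proof -
      have "(inf 0 (\<Omega>\<^sub>2 - D ** \<Omega>\<^sub>1)) $ i $ j \<le> 0" by (simp add: inf_vec_def)
      moreover have "0 \<le> K $ i $ j" using K by (simp add: less_eq_vec_def)
      ultimately have "T $ i $ j \<le> (\<langle>M' ** \<Omega>\<^sub>1\<rangle> - \<bar>N' ** \<Omega>\<^sub>1\<bar>) $ i $ j"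
        unfolding T_def by simp
      also have "\<dots> = (\<langle>M'\<rangle> - \<bar>N'\<bar>) $ i $ j * \<Omega>\<^sub>1 $ j $ j"
        using p1[of j] by (simp add: comparison_matrix_def abs_vec_def
            diagonal_matrix_mult_right[OF d1] abs_mult left_diff_distrib)
      also have "\<dots> \<le> \<langle>A\<rangle> $ i $ j * \<Omega>\<^sub>1 $ j $ j"
        using comparison_matrix_diff_le[of M' N'] p1[of j]
        by (intro mult_right_mono) (auto simp: less_eq_vec_def A_eq)
      finally show ?thesis by (simp add: diagonal_matrix_mult_right[OF d1])
    qed
    then have "T \<le> \<langle>A\<rangle> ** \<Omega>\<^sub>1" by (simp add: less_eq_vec_def)
    from less_le_trans[OF Tv mono[OF this]] show "0 < (\<langle>A\<rangle> *v (\<Omega>\<^sub>1 *v v)) $ i" for i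
      by (simp add: matrix_vector_mul_assoc)
  qed
  obtain x where x: "\<Omega>\<^sub>1 *v (\<bar>x\<bar> + x) = \<gamma> *\<^sub>R (zstar - \<zeta> zstar)"
    "\<Omega>\<^sub>2 *v (\<bar>x\<bar> - x) = \<gamma> *\<^sub>R (A *v zstar + q)"
    using ICP_solution_modulus[OF \<Omega>\<^sub>1 \<Omega>\<^sub>2 \<gamma> solution] .
  define X where "X = NRMAOR_x A M N \<phi> \<Omega>\<^sub>1 \<Omega>\<^sub>2 \<gamma> q \<zeta> x0"
  define Z where "Z y = matrix_inv A *v ((1 / \<gamma>) *\<^sub>R (\<Omega>\<^sub>2 *v (\<bar>y\<bar> - y)) - q)" for y
  note Z = NRMAOR_z_of_eq[OF invA, of q \<Omega>\<^sub>2 \<gamma>, folded Z_def]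
  have AZ: "A *v Z y = (1 / \<gamma>) *\<^sub>R (\<Omega>\<^sub>2 *v (\<bar>y\<bar> - y)) - q" for y
    by (simp add: Z_def matrix_vector_mul_assoc matrix_inv[OF invA])
  have invP: "invertible P" using nonsing unfolding fold .
  \<comment> \<open>Multiplication by \<open>P\<close> removes the inverse, which puts the recursion
    into the form required by the error bound.\<close>
  have PX: "P *v X (Suc k) = (N' ** \<Omega>\<^sub>1) *v X k + (\<Omega>\<^sub>2 - A ** \<Omega>\<^sub>1) *v \<bar>X k\<bar>
      - \<gamma> *\<^sub>R (A *v \<zeta> (Z (X k))) - \<gamma> *\<^sub>R q" for k
    by (simp add: X_def fold Z Let_def matrix_vector_mul_assoc matrix_inv[OF invP])
  have "X \<longlonglongrightarrow> x"
  proof (rule tendsto_if_weighted_contraction[OF v \<theta>(1,2)])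
    fix k s assume s: "0 \<le> s" "\<bar>X k - x\<bar> \<le> s *\<^sub>R v"
    have "\<bar>P *v (X (Suc k) - x)\<bar> \<le> R *v \<bar>X k - x\<bar>"
      unfolding R_def K_def P_def
      by (rule NRMAOR_error_bound[OF A_eq invA nonneg2 \<gamma> \<Psi>_nonneg \<zeta> x AZ PX[unfolded P_def]])
    also have "\<dots> \<le> R *v (s *\<^sub>R v)"
      using R s by (intro matrix_vector_mult_mono) auto
    also have "\<dots> \<le> (s * \<theta>) *\<^sub>R (\<langle>P\<rangle> *v v)"
      using scaleR_left_mono[OF \<theta>(3) s(1)] by (simp add: matrix_vector_mult_scaleR)
    \<comment> \<open>The chain bounds \<open>P\<close> applied to the new error by a multiple of
      \<open>\<langle>P\<rangle> *v v\<close>; this is what is needed to pass to the error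
      itself.\<close>
    finally show "\<bar>X (Suc k) - x\<bar> \<le> (s * \<theta>) *\<^sub>R v"
      by (rule comparison_matrix_bound[OF v Pv])
  qed
  \<comment> \<open>\<open>Z\<close> is composed of the entrywise absolute value and affine maps,
    hence continuous. The second modulus relation identifies \<open>Z x\<close> with
    \<open>zstar\<close>.\<close>
  then have "(\<lambda>k. Z (X k)) \<longlonglongrightarrow> Z x"
    unfolding Z_def abs_vec_def
    by (intro tendsto_intros tendsto_vec_lambda bounded_linear.tendsto[OF matrix_vector_mul_bounded_linear])
  moreover have "Z x = zstar"
    using \<gamma> by (simp add: Z_def x matrix_vector_mul_assoc matrix_inv[OF invA])
  moreover have "NRMAOR_z A M N \<phi> \<Omega>\<^sub>1 \<Omega>\<^sub>2 \<gamma> q \<zeta> x0 = (\<lambda>k. Z (X k))"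
    by (simp add: NRMAOR_z_def X_def Z fun_eq_iff)
  ultimately show ?thesis by simp
qed

end
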